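(* Let $G=(V,E)$ be a simple digraph and let $v_i,v_j\in V$ be vertices with $(v_i,v_j)\in E$. Then $\mathcal{E}^+(v_i)\,\mathcal{E}^-(v_j)\geq 1$.
   Context: A (simple) digraph is a pair $G=(V,E)$ with $V=\{v_1,\dots,v_n\}$ a finite set and $E\subset V\times V$ such that $(v,v)\notin E$ for all $v\in V$ (both $(v,w)$ and $(w,v)$ may belong to $E$). Its adjacency matrix $A$ is the $n\times n$ matrix with $A_{ij}=1$ if $(v_i,v_j)\in E$ and $A_{ij}=0$ otherwise. The outer energy of the vertex $v_i$ is $\mathcal{E}^+(v_i)=\mathcal{E}^+_G(v_i)=\big((AA^t)^{1/2}\big)_{ii}$, and the inner energy of $v_i$ is $\mathcal{E}^-(v_i)=\mathcal{E}^-_G(v_i)=\big((A^tA)^{1/2}\big)_{ii}$, where the square roots are the positive semidefinite ones. *)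

theory Defs
  imports "Graph_Theory.Pair_Digraph" "Jordan_Normal_Form.Matrix"
begin

(* A simple digraph is an instance of the locale pair_digraph: finite, without loops, and with
   arcs that are pairs of vertices; opposite arcs (v, w) and (w, v) may both be present.

   The numbering v_1, ..., v_n of the vertices is a list vs that contains every vertex
   exactly once. Indices start at 0, as in the matrix library. *)
definition vertex_numbering :: "'a pair_pre_digraph \<Rightarrow> 'a list \<Rightarrow> bool" where
  "vertex_numbering G vs \<longleftrightarrow> distinct vs \<and> set vs = pverts G"

definition adjacency_mat :: "'a pair_pre_digraph \<Rightarrow> 'a list \<Rightarrow> real mat" where
  "adjacency_mat G vs =
     mat (length vs) (length vs) (\<lambda>(i, j). if (vs ! i, vs ! j) \<in> parcs G then 1 else 0)"

definition pos_semidef_mat :: "nat \<Rightarrow> real mat \<Rightarrow> bool" where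
  "pos_semidef_mat n M \<longleftrightarrow>
     M \<in> carrier_mat n n \<and> transpose_mat M = M \<and>
     (\<forall>x \<in> carrier_vec n. 0 \<le> x \<bullet> (M *\<^sub>v x))"

(* Only meaningful for positive semidefinite M, where the square root exists and is unique. *)
definition psd_sqrt :: "real mat \<Rightarrow> real mat" where
  "psd_sqrt M = (THE B. pos_semidef_mat (dim_row M) B \<and> B * B = M)"

definition outer_energy :: "'a pair_pre_digraph \<Rightarrow> 'a list \<Rightarrow> nat \<Rightarrow> real" where
  "outer_energy G vs i =
     psd_sqrt (adjacency_mat G vs * transpose_mat (adjacency_mat G vs)) $$ (i, i)"

definition inner_energy :: "'a pair_pre_digraph \<Rightarrow> 'a list \<Rightarrow> nat \<Rightarrow> real" where
  "inner_energy G vs i =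
     psd_sqrt (transpose_mat (adjacency_mat G vs) * adjacency_mat G vs) $$ (i, i)"

end

theory Submission
  imports Defs "Jordan_Normal_Form.Spectral_Radius" "HOL-Analysis.L2_Norm"
begin

text \<open>
  Diagonalise \<open>A\<^sup>T A = U diag(s\<^sup>2) U\<^sup>T\<close> and put \<open>W = A U\<close>. The columns of \<open>W\<close> are orthogonal with
  norms \<open>s\<close>, so \<open>Q = U diag(s) U\<^sup>T\<close> and \<open>P = W diag(1/s) W\<^sup>T\<close> are the square roots of \<open>A\<^sup>T A\<close>
  and \<open>A A\<^sup>T\<close>. Since \<open>A = W U\<^sup>T\<close>, the Cauchy-Schwarz inequality for
  \<open>A\<^sub>i\<^sub>j = \<Sum>\<^sub>k (W\<^sub>i\<^sub>k / \<surd>s\<^sub>k) (\<surd>s\<^sub>k U\<^sub>j\<^sub>k)\<close> gives \<open>A\<^sub>i\<^sub>j\<^sup>2 \<le> P\<^sub>i\<^sub>i Q\<^sub>j\<^sub>j\<close>, and an arc has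
  \<open>A\<^sub>i\<^sub>j = 1\<close>.
\<close>

section \<open>Spectral theorem for real symmetric matrices\<close>

text \<open>Over the complex numbers the spectrum is nonempty. Once the eigenvalue is known to be
  real, the real and imaginary parts of a complex eigenvector both satisfy the eigenvalue equation;
  one of them is nonzero and can be normalised.\<close>

lemma symmetric_eigenvector_exists:
  fixes M :: "real mat"
  assumes M: "M \<in> carrier_mat n n" and sym: "transpose_mat M = M" and n: "n > 0"
  obtains v a where "v \<in> carrier_vec n" "v \<bullet> v = 1" "M *\<^sub>v v = a \<cdot>\<^sub>v v"
proof -
  let ?C = "map_mat complex_of_real M"
  have C: "?C \<in> carrier_mat n n" using M by simp
  obtain \<mu> where "eigenvalue ?C \<mu>"
    using spectrum_non_empty[OF C] n unfolding spectrum_def by auto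
  then obtain z where z: "z \<in> carrier_vec n" "z \<noteq> 0\<^sub>v n" and ev: "?C *\<^sub>v z = \<mu> \<cdot>\<^sub>v z"
    using M unfolding eigenvalue_def eigenvector_def by auto
  define x where "x = map_vec Re z"
  define y where "y = map_vec Im z"
  have xy: "x \<in> carrier_vec n" "y \<in> carrier_vec n" using z by (auto simp: x_def y_def)
  \<comment> \<open>The real scalar action \<open>*\<^sub>R\<close> lets \<open>Re\<close> and
    \<open>Im\<close> pass through the sum, which gives the equations for \<open>x\<close> and
    \<open>y\<close> below.\<close>
  have comp: "(\<Sum>j<n. M $$ (i, j) *\<^sub>R z $ j) = \<mu> * z $ i" if "i < n" for i
    using arg_cong[OF ev, of "\<lambda>w. w $ i"] that M z
    by (simp add: scalar_prod_def scaleR_conv_of_real atLeast0LessThan)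
  have Mx: "M *\<^sub>v x = Re \<mu> \<cdot>\<^sub>v x - Im \<mu> \<cdot>\<^sub>v y"
  proof (rule eq_vecI)
    fix i assume "i < dim_vec (Re \<mu> \<cdot>\<^sub>v x - Im \<mu> \<cdot>\<^sub>v y)"
    then have i: "i < n" using xy by simp
    then show "(M *\<^sub>v x) $ i = (Re \<mu> \<cdot>\<^sub>v x - Im \<mu> \<cdot>\<^sub>v y) $ i"
      using arg_cong[OF comp[OF i], of Re] M z
      by (simp add: x_def y_def scalar_prod_def atLeast0LessThan)
  qed (use M xy in auto)
  have My: "M *\<^sub>v y = Im \<mu> \<cdot>\<^sub>v x + Re \<mu> \<cdot>\<^sub>v y"
  proof (rule eq_vecI)
    fix i assume "i < dim_vec (Im \<mu> \<cdot>\<^sub>v x + Re \<mu> \<cdot>\<^sub>v y)"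
    then have i: "i < n" using xy by simp
    then show "(M *\<^sub>v y) $ i = (Im \<mu> \<cdot>\<^sub>v x + Re \<mu> \<cdot>\<^sub>v y) $ i"
      using arg_cong[OF comp[OF i], of Im] M z
      by (simp add: x_def y_def scalar_prod_def atLeast0LessThan)
  qed (use M xy in auto)
  have pos: "w \<bullet> w > 0" if "w \<in> carrier_vec n" "w \<noteq> 0\<^sub>v n" for w :: "real vec"
    using conjugate_square_greater_0_vec[OF that(1)] that by (simp add: conjugate_real_def)
  have xy0: "x \<noteq> 0\<^sub>v n \<or> y \<noteq> 0\<^sub>v n"
  proof (rule ccontr)
    assume "\<not> ?thesis"
    then have "Re (z $ i) = 0" "Im (z $ i) = 0" if "i < n" for i
      using that z index_map_vec(1)[of i z Re] index_map_vec(1)[of i z Im]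
      by (auto simp flip: x_def y_def)
    then have "z = 0\<^sub>v n" using z by (intro eq_vecI) (auto simp: complex_eq_iff)
    then show False using z by simp
  qed
  \<comment> \<open>Symmetry of \<open>M\<close> on the real and imaginary parts of an eigenvector forces a real eigenvalue.\<close>
  have "x \<bullet> (M *\<^sub>v y) = (M *\<^sub>v x) \<bullet> y"
    using transpose_vec_mult_scalar[OF M xy(2,1)] sym by simp
  then have "Im \<mu> * (x \<bullet> x + y \<bullet> y) = 0"
    using xy comm_scalar_prod[OF xy]
    by (simp add: Mx My scalar_prod_add_distrib[of _ n] minus_scalar_prod_distrib[of _ n] algebra_simps)
  moreover have "x \<bullet> x + y \<bullet> y > 0"
    using xy0 pos[OF xy(1)] pos[OF xy(2)] scalar_prod_left_zero[of "0\<^sub>v n" n]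
    by (cases "x = 0\<^sub>v n"; cases "y = 0\<^sub>v n") auto
  ultimately have b: "Im \<mu> = 0" by simp
  have Mxy: "M *\<^sub>v x = Re \<mu> \<cdot>\<^sub>v x" "M *\<^sub>v y = Re \<mu> \<cdot>\<^sub>v y"
    using xy unfolding Mx My b by auto
  obtain w where w: "w \<in> carrier_vec n" "w \<noteq> 0\<^sub>v n" "M *\<^sub>v w = Re \<mu> \<cdot>\<^sub>v w"
    using xy0 xy Mxy by blast
  define c where "c = 1 / sqrt (w \<bullet> w)"
  have "(c \<cdot>\<^sub>v w) \<bullet> (c \<cdot>\<^sub>v w) = 1"
    using w pos[OF w(1,2)] by (simp add: c_def)
  moreover have "M *\<^sub>v (c \<cdot>\<^sub>v w) = Re \<mu> \<cdot>\<^sub>v (c \<cdot>\<^sub>v w)"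
    using w M by (simp add: mult_mat_vec smult_smult_assoc mult.commute)
  ultimately show ?thesis using that[of "c \<cdot>\<^sub>v w"] w by simp
qed

text \<open>A symmetric involution is orthogonal, so conjugation by \<open>H\<close> preserves
  symmetry and moves the eigenvector \<open>v\<close> to the first coordinate. This replaces
  completing \<open>v\<close> to an orthonormal basis.\<close>

lemma reflection_exists:
  fixes v :: "real vec"
  assumes v: "v \<in> carrier_vec n" and unit: "v \<bullet> v = 1" and n: "n > 0"
  obtains H where "H \<in> carrier_mat n n" "transpose_mat H = H" "H * H = 1\<^sub>m n"
    "H *\<^sub>v unit_vec n 0 = v"
proof -
  \<comment> \<open>Householder reflection along \<open>w\<close>; if \<open>v\<close> is the unit vector itself, then \<open>c = 1 / 0 = 0\<close>
    and \<open>H\<close> is the identity.\<close>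
  define w where "w = unit_vec n 0 - v"
  \<comment> \<open>The usual Householder coefficient \<open>2 / (w \<bullet> w)\<close>, since
    \<open>w \<bullet> w = 2 * (1 - v $ 0)\<close> for a unit vector \<open>v\<close>.\<close>
  define c where "c = 1 / (1 - v $ 0)"
  define H where "H = mat n n (\<lambda>(i, j). (if i = j then 1 else 0) - c * w $ i * w $ j)"
  have w: "w \<in> carrier_vec n" using v by (simp add: w_def)
  have w0: "w $ 0 = 1 - v $ 0" using n v by (simp add: w_def)
  have ww: "w \<bullet> w = 2 * (1 - v $ 0)"
  proof -
    have "w \<bullet> w = (unit_vec n 0 - v) \<bullet> unit_vec n 0 - (unit_vec n 0 - v) \<bullet> v"
      unfolding w_def using v by (subst scalar_prod_minus_distrib[of _ n]) auto
    then show ?thesis using v n unit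
      by (simp add: minus_scalar_prod_distrib[of _ n])
  qed
  then have ww': "(\<Sum>k<n. w $ k * w $ k) = 2 * (1 - v $ 0)"
    using w by (simp add: scalar_prod_def atLeast0LessThan)
  have H: "H \<in> carrier_mat n n" by (simp add: H_def)
  moreover have "transpose_mat H = H" by (rule eq_matI) (auto simp: H_def)
  moreover have "H * H = 1\<^sub>m n"
  proof (rule eq_matI)
    fix i j assume ij: "i < dim_row (1\<^sub>m n :: real mat)" "j < dim_col (1\<^sub>m n :: real mat)"
    let ?d = "\<lambda>i j. if i = j then 1 else 0 :: real"
    have "(H * H) $$ (i, j) = (\<Sum>k<n. (?d i k - c * w $ i * w $ k) * (?d k j - c * w $ k * w $ j))"
      using ij by (simp add: H_def scalar_prod_def atLeast0LessThan)
    also have "\<dots> = (\<Sum>k<n. ?d i k * ?d k j - ?d i k * (c * w $ k * w $ j) - ?d k j * (c * w $ i * w $ k)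
        + c * c * w $ i * w $ j * (w $ k * w $ k))"
      by (intro sum.cong) (auto simp: algebra_simps)
    also have "\<dots> = ?d i j - 2 * c * w $ i * w $ j + c * c * w $ i * w $ j * (2 * (1 - v $ 0))"
      using ij by (simp add: sum.distrib sum_subtractf flip: sum_distrib_left)
        (simp add: ww' if_distrib[of "\<lambda>x. x * _"] cong: if_cong)
    also have "\<dots> = ?d i j + 2 * w $ i * w $ j * (c * c * (1 - v $ 0) - c)"
      by (simp add: algebra_simps)
    \<comment> \<open>Also true for \<open>v $ 0 = 1\<close>, where \<open>c = 0\<close>.\<close>
    also have "c * c * (1 - v $ 0) = c" by (simp add: c_def)
    finally show "(H * H) $$ (i, j) = 1\<^sub>m n $$ (i, j)" using ij by simp
  qed (auto simp: H_def)
  moreover have "H *\<^sub>v unit_vec n 0 = v"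
  proof (rule eq_vecI)
    fix i assume "i < dim_vec v"
    then have i: "i < n" using v by simp
    have "(H *\<^sub>v unit_vec n 0) $ i = (if i = 0 then 1 else 0) - c * (1 - v $ 0) * w $ i"
      using i n by (simp add: H_def w0)
    also have "\<dots> = (if i = 0 then 1 else 0) - w $ i"
    \<comment> \<open>The factor \<open>c * (1 - v $ 0)\<close> equals 1 unless
      \<open>v $ 0 = 1\<close>; in that case \<open>w \<bullet> w = 0\<close>, so \<open>w\<close>
      itself vanishes.\<close>
    proof (cases "1 - v $ 0 = 0")
      case True
      then have "w = 0\<^sub>v n"
        using ww w conjugate_square_eq_0_vec[OF w] by (simp add: conjugate_real_def)
      then show ?thesis using i by simp
    qed (simp add: c_def)
    finally show "(H *\<^sub>v unit_vec n 0) $ i = v $ i" using i v by (simp add: w_def)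
  qed (use v in \<open>simp add: H_def\<close>)
  ultimately show ?thesis using that by blast
qed

text \<open>Deflation: a reflection taking the first basis vector to a unit eigenvector splits off a
  1 by 1 block, and the induction hypothesis diagonalises the remaining symmetric block.\<close>

lemma real_spectral_theorem:
  fixes M :: "real mat"
  assumes "M \<in> carrier_mat n n" and "transpose_mat M = M"
  shows "\<exists>U d. U \<in> carrier_mat n n \<and> transpose_mat U * U = 1\<^sub>m n \<and>
    M = U * mat_diag n d * transpose_mat U"
  using assms
proof (induction n arbitrary: M)
  case 0
  then show ?case by (intro exI[of _ "1\<^sub>m 0"] exI[of _ "\<lambda>_. 0"] conjI) (auto intro!: eq_matI)
next
  case (Suc n M)
  let ?N = "Suc n"
  note M = Suc.prems(1)
  obtain v a where v: "v \<in> carrier_vec ?N" "v \<bullet> v = 1" "M *\<^sub>v v = a \<cdot>\<^sub>v v"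
    using symmetric_eigenvector_exists[OF Suc.prems] by blast
  obtain H where H: "H \<in> carrier_mat ?N ?N" and HT: "transpose_mat H = H"
    and HH: "H * H = 1\<^sub>m ?N" and He: "H *\<^sub>v unit_vec ?N 0 = v"
    using reflection_exists[OF v(1,2)] by blast
  define K where "K = H * M * H"
  have K: "K \<in> carrier_mat ?N ?N" using H M by (simp add: K_def)
  have Ksym: "transpose_mat K = K"
    using H M HT Suc.prems(2)
    by (simp add: K_def transpose_mult[of _ ?N ?N _ ?N] assoc_mult_mat[of _ ?N ?N _ ?N _ ?N])
  have Hv: "H *\<^sub>v v = unit_vec ?N 0"
    unfolding He[symmetric] using H HH by (simp flip: assoc_mult_mat_vec)
  have Ke: "K *\<^sub>v unit_vec ?N 0 = a \<cdot>\<^sub>v unit_vec ?N 0"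
    using H M v Hv
    by (simp add: K_def assoc_mult_mat_vec[of _ ?N ?N _ ?N] He mult_mat_vec[of _ ?N ?N])
  \<comment> \<open>The eigenvector equation fixes column 0 of \<open>K\<close>; symmetry carries it
    over to row 0, so \<open>K\<close> is block diagonal.\<close>
  have K0: "K $$ (i, 0) = (if i = 0 then a else 0)" if "i < ?N" for i
    using arg_cong[OF Ke, of "\<lambda>w. w $ i"] that K by simp
  have K0': "K $$ (0, i) = (if i = 0 then a else 0)" if "i < ?N" for i
    using K0[OF that] arg_cong[OF Ksym, of "\<lambda>B. B $$ (i, 0)"] that K by simp
  define L where "L = mat n n (\<lambda>(i, j). K $$ (Suc i, Suc j))"
  have L: "L \<in> carrier_mat n n" by (simp add: L_def)
  have "transpose_mat L = L"
  proof (rule eq_matI)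
    fix i j assume "i < dim_row L" "j < dim_col L"
    then show "transpose_mat L $$ (i, j) = L $$ (i, j)"
      using arg_cong[OF Ksym, of "\<lambda>B. B $$ (Suc i, Suc j)"] K by (simp add: L_def)
  qed (auto simp: L_def)
  then obtain V e where V: "V \<in> carrier_mat n n" and VV: "transpose_mat V * V = 1\<^sub>m n"
    and LV: "L = V * mat_diag n e * transpose_mat V"
    using Suc.IH[OF L] by blast
  define E where "E = four_block_mat (1\<^sub>m 1) (0\<^sub>m 1 n) (0\<^sub>m n 1) V"
  \<comment> \<open>The split-off eigenvalue \<open>a\<close> takes index 0 and the values of
    \<open>e\<close> move up by one.\<close>
  define d where "d = case_nat a e"
  have E: "E \<in> carrier_mat ?N ?N" using V by (auto simp: E_def)
  have ET: "transpose_mat E = four_block_mat (1\<^sub>m 1) (0\<^sub>m 1 n) (0\<^sub>m n 1) (transpose_mat V)"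
    unfolding E_def using V by (subst transpose_four_block_mat[of _ 1 1 _ n _ n]) auto
  have "transpose_mat E * E = four_block_mat (1\<^sub>m 1) (0\<^sub>m 1 n) (0\<^sub>m n 1) (1\<^sub>m n)"
    unfolding ET unfolding E_def using V VV
    by (subst mult_four_block_mat[of _ 1 1 _ n _ n _ _ 1 _ n]) auto
  then have EE: "transpose_mat E * E = 1\<^sub>m ?N" by simp
  have D: "mat_diag ?N d = four_block_mat (a \<cdot>\<^sub>m 1\<^sub>m 1) (0\<^sub>m 1 n) (0\<^sub>m n 1) (mat_diag n e)"
    by (rule eq_matI) (auto simp: mat_diag_def d_def split: nat.splits)
  have Kblock: "K = four_block_mat (a \<cdot>\<^sub>m 1\<^sub>m 1) (0\<^sub>m 1 n) (0\<^sub>m n 1) L"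
    using K by (intro eq_matI) (auto simp: L_def K0 K0')
  have "E * mat_diag ?N d = four_block_mat (a \<cdot>\<^sub>m 1\<^sub>m 1) (0\<^sub>m 1 n) (0\<^sub>m n 1) (V * mat_diag n e)"
    unfolding E_def D using V left_mult_zero_mat[OF mat_diag_dim, of 1 n e]
    by (subst mult_four_block_mat[of _ 1 1 _ n _ n _ _ 1 _ n]) auto
  then have KE: "K = E * mat_diag ?N d * transpose_mat E"
    unfolding ET Kblock
    using V LV right_mult_zero_mat[OF mult_carrier_mat[OF V mat_diag_dim, of e], of 1]
      mult_carrier_mat[OF mult_carrier_mat[OF V mat_diag_dim, of e], of "transpose_mat V" n]
    by (simp only:, subst mult_four_block_mat[of _ 1 1 _ n _ n _ _ 1 _ n]) auto
  \<comment> \<open>\<open>E\<close> diagonalises \<open>K\<close>, and \<open>M = H * K * H\<close>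
    because \<open>H\<close> is an involution.\<close>
  define U where "U = H * E"
  have U: "U \<in> carrier_mat ?N ?N" using H E by (simp add: U_def)
  have UT: "transpose_mat U = transpose_mat E * H"
    using H E HT by (simp add: U_def transpose_mult[of _ ?N ?N _ ?N])
  have ET': "transpose_mat E \<in> carrier_mat ?N ?N" using E by simp
  have "transpose_mat U * U = transpose_mat E * (H * H) * E"
    unfolding UT unfolding U_def using H E ET' by (simp add: assoc_mult_mat[of _ ?N ?N _ ?N _ ?N])
  then have UU: "transpose_mat U * U = 1\<^sub>m ?N" using HH EE ET' by simp
  have ED: "E * mat_diag ?N d \<in> carrier_mat ?N ?N" by (rule mult_carrier_mat[OF E mat_diag_dim])
  have HM: "H * M \<in> carrier_mat ?N ?N" by (rule mult_carrier_mat[OF H M])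
  have "U * mat_diag ?N d * transpose_mat U = H * K * H"
    unfolding UT KE unfolding U_def assoc_mult_mat[OF H E mat_diag_dim]
      assoc_mult_mat[OF H ED ET'] assoc_mult_mat[OF mult_carrier_mat[OF H ED] ET' H, symmetric] ..
  also have "\<dots> = (H * H) * M * (H * H)"
    unfolding K_def assoc_mult_mat[OF H HM H, symmetric] assoc_mult_mat[OF H H M, symmetric]
    by (rule assoc_mult_mat[OF mult_carrier_mat[OF mult_carrier_mat[OF H H] M] H H])
  also have "\<dots> = M" using HH M by simp
  finally have M_eq: "U * mat_diag ?N d * transpose_mat U = M" .
  show ?case by (intro exI[of _ U] exI[of _ d] conjI U UU M_eq[symmetric])
qed

section \<open>Positive semidefinite square roots and their uniqueness\<close>

text \<open>With \<open>y = transpose_mat W *\<^sub>v x\<close>, the quadratic form is the sum of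
  \<open>t k * (y $ k)\<^sup>2\<close>. A rectangular \<open>W\<close> is allowed so that both
  square roots constructed later are covered.\<close>

lemma pos_semidef_mat_congruence_diag:
  assumes W: "W \<in> carrier_mat m n" and t: "\<And>k. k < n \<Longrightarrow> 0 \<le> t k"
  shows "pos_semidef_mat m (W * mat_diag n t * transpose_mat W)"
  unfolding pos_semidef_mat_def
proof (intro conjI ballI)
  let ?D = "mat_diag n t"
  have WT: "transpose_mat W \<in> carrier_mat n m" using W by simp
  show "W * ?D * transpose_mat W \<in> carrier_mat m m"
    using W WT by (intro mult_carrier_mat[of _ m n]) auto
  have "transpose_mat ?D = ?D" by (rule eq_matI) (auto simp: mat_diag_def)
  then show "transpose_mat (W * ?D * transpose_mat W) = W * ?D * transpose_mat W"
    using W WT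
    by (simp add: transpose_mult[of _ m n _ m] transpose_mult[of _ m n _ n] transpose_mult[of _ n n _ m]
        assoc_mult_mat[of _ m n _ n _ m] mult_carrier_mat[of _ m n _ n] mult_carrier_mat[of _ n n _ m])
  fix x :: "real vec" assume x: "x \<in> carrier_vec m"
  define y where "y = transpose_mat W *\<^sub>v x"
  have y: "y \<in> carrier_vec n" using WT x by (simp add: y_def)
  have Dy: "(?D *\<^sub>v y) $ k = t k * y $ k" if "k < n" for k
  proof -
    have "(?D *\<^sub>v y) $ k = (\<Sum>l<n. (if k = l then t l else 0) * y $ l)"
      using that y by (simp add: mat_diag_def scalar_prod_def atLeast0LessThan)
    also have "\<dots> = (\<Sum>l<n. if k = l then t l * y $ l else 0)"
      by (rule sum.cong) auto
    finally show ?thesis using that by simp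
  qed
  have "x \<bullet> (W * ?D * transpose_mat W *\<^sub>v x) = x \<bullet> (W *\<^sub>v (?D *\<^sub>v y))"
    using W WT x y
    by (simp add: y_def assoc_mult_mat_vec[of _ m n _ m] assoc_mult_mat_vec[of _ m n _ n])
  also have "\<dots> = y \<bullet> (?D *\<^sub>v y)"
    unfolding y_def
    using transpose_vec_mult_scalar[OF W mult_mat_vec_carrier[OF mat_diag_dim y] x] by (simp add: y_def)
  also have "\<dots> = (\<Sum>k<n. t k * (y $ k)\<^sup>2)"
    using carrier_vecD[OF mult_mat_vec_carrier[OF mat_diag_dim y, of t]] Dy
    by (simp add: scalar_prod_def atLeast0LessThan power2_eq_square algebra_simps del: index_mult_mat_vec)
  finally show "0 \<le> x \<bullet> (W * ?D * transpose_mat W *\<^sub>v x)"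
    using t by (auto intro!: sum_nonneg)
qed

lemma index_congruence_diag:
  assumes W: "W \<in> carrier_mat m n" and U: "U \<in> carrier_mat m' n" and "i < m" "j < m'"
  shows "(W * mat_diag n t * transpose_mat U) $$ (i, j) =
    (\<Sum>k<n. W $$ (i, k) * t k * (U $$ (j, k) :: real))"
  using assms by (simp add: mat_diag_mult_right[OF W] scalar_prod_def atLeast0LessThan)


text \<open>Factor \<open>C * C - b * b\<close> as \<open>(C + b) (C - b)\<close>: the vector
  \<open>w = C v - b v\<close> satisfies \<open>C w = - b w\<close>, which for \<open>b > 0\<close>
  contradicts positivity unless \<open>w = 0\<close>. For \<open>b = 0\<close>, symmetry gives that
  the squared norm of \<open>C v\<close> is \<open>v \<bullet> (C (C v)) = 0\<close>.\<close>

lemma pos_semidef_mat_eigenvector_of_square: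
  assumes C: "pos_semidef_mat n C" and v: "v \<in> carrier_vec n" and b: "0 \<le> b"
    and ev: "(C * C) *\<^sub>v v = (b * b) \<cdot>\<^sub>v v"
  shows "C *\<^sub>v v = b \<cdot>\<^sub>v v"
proof -
  have Cm: "C \<in> carrier_mat n n" and CT: "transpose_mat C = C"
    and pos: "\<And>x. x \<in> carrier_vec n \<Longrightarrow> 0 \<le> x \<bullet> (C *\<^sub>v x)"
    using C by (auto simp: pos_semidef_mat_def)
  define u where "u = C *\<^sub>v v"
  have u: "u \<in> carrier_vec n" using Cm v by (simp add: u_def)
  have Cu: "C *\<^sub>v u = (b * b) \<cdot>\<^sub>v v"
    using ev Cm v by (simp add: u_def)
  have zero: "x = 0\<^sub>v n" if "x \<in> carrier_vec n" "x \<bullet> x = 0" for x :: "real vec"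
    using conjugate_square_eq_0_vec[OF that(1)] that by (simp add: conjugate_real_def)
  show ?thesis
  proof (cases "b = 0")
    case True
    have "u \<bullet> u = v \<bullet> (C *\<^sub>v u)"
      using transpose_vec_mult_scalar[OF Cm u v] CT by (simp add: u_def)
    also have "\<dots> = 0" using v by (simp add: Cu True)
    finally have "u = 0\<^sub>v n" using zero[OF u] by simp
    moreover have "b \<cdot>\<^sub>v v = 0\<^sub>v n" using v True by auto
    ultimately show ?thesis by (simp add: u_def)
  next
    case False
    define w where "w = u - b \<cdot>\<^sub>v v"
    have w: "w \<in> carrier_vec n" using u v by (simp add: w_def)
    have "C *\<^sub>v w = (b * b) \<cdot>\<^sub>v v - b \<cdot>\<^sub>v u"
      unfolding w_def using Cm u v
      by (simp add: mult_minus_distrib_mat_vec[of _ n n] mult_mat_vec[of _ n n] Cu flip: u_def)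
    also have "\<dots> = (- b) \<cdot>\<^sub>v w"
      unfolding w_def using u v by (auto simp: algebra_simps)
    finally have "w \<bullet> (C *\<^sub>v w) = - b * (w \<bullet> w)" using w by simp
    moreover have "0 \<le> w \<bullet> w" using w by (auto simp: scalar_prod_def intro: sum_nonneg)
    ultimately have "w \<bullet> w = 0"
      using pos[OF w] b False by (simp add: mult_le_0_iff)
    then have "w = 0\<^sub>v n" by (rule zero[OF w])
    then have "w $ i = 0" if "i < n" for i using that by simp
    then show ?thesis using u v by (intro eq_vecI) (auto simp: w_def simp flip: u_def)
  qed
qed

text \<open>An orthonormal eigenbasis of \<open>B\<close> consists of eigenvectors of
  \<open>B * B = C * C\<close>, hence of \<open>C\<close> with the same nonnegative eigenvalues; so
  \<open>B\<close> and \<open>C\<close> agree on a basis.\<close>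

lemma pos_semidef_mat_square_inject:
  assumes B: "pos_semidef_mat n B" and C: "pos_semidef_mat n C" and eq: "B * B = C * C"
  shows "B = C"
proof -
  have Bm: "B \<in> carrier_mat n n" "transpose_mat B = B" and Cm: "C \<in> carrier_mat n n"
    and pos: "\<And>x. x \<in> carrier_vec n \<Longrightarrow> 0 \<le> x \<bullet> (B *\<^sub>v x)"
    using B C by (auto simp: pos_semidef_mat_def)
  obtain U b where U: "U \<in> carrier_mat n n" and UU: "transpose_mat U * U = 1\<^sub>m n"
    and B_eq: "B = U * mat_diag n b * transpose_mat U"
    using real_spectral_theorem[OF Bm] by blast
  have UT: "transpose_mat U \<in> carrier_mat n n" using U by simp
  have UU': "U * transpose_mat U = 1\<^sub>m n" by (rule mat_mult_left_right_inverse[OF UT U UU])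
  have "B * U = U * mat_diag n b * (transpose_mat U * U)"
    unfolding B_eq using U UT
    by (simp add: assoc_mult_mat[of _ n n _ n _ n] mult_carrier_mat[of _ n n _ n])
  then have BU: "B * U = U * mat_diag n b" 
    unfolding UU right_mult_one_mat[OF mult_carrier_mat[OF U mat_diag_dim]] .
  have ev: "B *\<^sub>v col U k = b k \<cdot>\<^sub>v col U k" if "k < n" for k
  proof -
    have "B *\<^sub>v col U k = col (B * U) k" using that Bm U by (simp add: col_mult2[of _ n n])
    also have "\<dots> = b k \<cdot>\<^sub>v col U k"
      unfolding BU using U that by (auto simp: mat_diag_mult_right[of _ n])
    finally show ?thesis .
  qed
  have "C *\<^sub>v col U k = B *\<^sub>v col U k" if k: "k < n" for k
  proof -
    have u: "col U k \<in> carrier_vec n" using U k by simp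
    \<comment> \<open>For a unit eigenvector the quadratic form of \<open>B\<close> equals
      \<open>b k\<close>, so positivity yields \<open>b k \<ge> 0\<close>.\<close>
    have "col U k \<bullet> col U k = (transpose_mat U * U) $$ (k, k)" using U k by simp
    then have "col U k \<bullet> col U k = 1" using UU k by simp
    then have "b k \<ge> 0" using pos[OF u] u by (simp add: ev[OF k])
    moreover have "(C * C) *\<^sub>v col U k = (b k * b k) \<cdot>\<^sub>v col U k"
      using Bm u by (simp add: ev[OF k] mult_mat_vec[of _ n n] smult_smult_assoc flip: eq)
    ultimately show ?thesis
      using pos_semidef_mat_eigenvector_of_square[OF C u] ev[OF k] by simp
  qed
  then have "C * U = B * U"
    using Bm Cm U by (intro mat_col_eqI) (auto simp: col_mult2[of _ n n])
  then have "C * (U * transpose_mat U) = B * (U * transpose_mat U)"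
    unfolding assoc_mult_mat[OF Cm U UT, symmetric] assoc_mult_mat[OF Bm(1) U UT, symmetric]
    by (rule arg_cong)
  then show ?thesis
    unfolding UU' right_mult_one_mat[OF Cm] right_mult_one_mat[OF Bm(1)] by (rule sym)
qed

text \<open>Uniqueness resolves the definite description, so any explicit positive semidefinite root
  is the value of \<open>psd_sqrt\<close>.\<close>

lemma psd_sqrt_eqI:
  assumes "pos_semidef_mat n B" and "B * B = M"
  shows "psd_sqrt M = B"
proof -
  have "dim_row M = n" using assms by (auto simp: pos_semidef_mat_def)
  then show ?thesis
    unfolding psd_sqrt_def using assms pos_semidef_mat_square_inject
    by (intro the_equality) auto
qed

section \<open>Singular value decomposition and the entrywise inequality\<close>

lemma square_entry_le_psd_sqrt_diag:
  assumes A: "A \<in> carrier_mat m n" and i: "i < m" and j: "j < n"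
  shows "(A $$ (i, j))\<^sup>2 \<le>
    psd_sqrt (A * transpose_mat A) $$ (i, i) * psd_sqrt (transpose_mat A * A) $$ (j, j)"
proof -
  have AT: "transpose_mat A \<in> carrier_mat n m" using A by simp
  have AA: "transpose_mat A * A \<in> carrier_mat n n" using A by simp
  have "transpose_mat (transpose_mat A * A) = transpose_mat A * A"
    using A by (simp add: transpose_mult[of _ n m _ n])
  then obtain U d where U: "U \<in> carrier_mat n n" and UU: "transpose_mat U * U = 1\<^sub>m n"
    and AA_eq: "transpose_mat A * A = U * mat_diag n d * transpose_mat U"
    using real_spectral_theorem[OF AA] by blast
  have UT: "transpose_mat U \<in> carrier_mat n n" using U by simp
  have UU': "U * transpose_mat U = 1\<^sub>m n" by (rule mat_mult_left_right_inverse[OF UT U UU])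
  \<comment> \<open>The columns are left singular vectors scaled by the singular values. Leaving
    them unnormalised avoids a basis completion when some \<open>d k\<close> is zero.\<close>
  define W where "W = A * U"
  have W: "W \<in> carrier_mat m n" using A U by (simp add: W_def)
  have WT: "transpose_mat W \<in> carrier_mat n m" using W by simp
  have WT_eq: "transpose_mat W = transpose_mat U * transpose_mat A"
    using A U by (simp add: W_def transpose_mult[of _ m n _ n])
  have "transpose_mat W * W = transpose_mat U * (transpose_mat A * A) * U"
    unfolding WT_eq unfolding W_def using A AT U UT
    by (simp add: assoc_mult_mat[of _ n n _ m _ n] assoc_mult_mat[of _ n m _ n _ n]
        assoc_mult_mat[of _ n n _ n _ n])
  also have "\<dots> = (transpose_mat U * U) * mat_diag n d * (transpose_mat U * U)"
    unfolding AA_eq using U UT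
    by (simp add: assoc_mult_mat[of _ n n _ n _ n] mult_carrier_mat[of _ n n _ n])
  finally have WW: "transpose_mat W * W = mat_diag n d"
    using UU by (simp add: left_mult_one_mat[OF mat_diag_dim] right_mult_one_mat[OF mat_diag_dim])
  \<comment> \<open>The diagonal of \<open>transpose_mat W * W\<close> shows that \<open>d k\<close>
    is the squared norm of column \<open>k\<close>; hence \<open>d k\<close> is nonnegative, and the
    column vanishes when \<open>d k = 0\<close>.\<close>
  have d: "d k = (\<Sum>l<m. (W $$ (l, k))\<^sup>2)" if "k < n" for k
    using arg_cong[OF WW, of "\<lambda>B. B $$ (k, k)"] that W
    by (simp add: mat_diag_def scalar_prod_def atLeast0LessThan power2_eq_square)
  then have d_nonneg: "0 \<le> d k" if "k < n" for k using that by (simp add: sum_nonneg)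
  have W_zero: "W $$ (l, k) = 0" if "k < n" "d k = 0" "l < m" for k l
    using d[OF that(1)] that by (simp add: sum_nonneg_eq_0_iff)
  define s where "s k = sqrt (d k)" for k
  have s: "0 \<le> s k" "s k * s k = d k" if "k < n" for k
    using d_nonneg[OF that] by (simp_all add: s_def)
  let ?Q = "U * mat_diag n s * transpose_mat U"
  let ?P = "W * mat_diag n (\<lambda>k. 1 / s k) * transpose_mat W"
  have "?Q * ?Q = U * (mat_diag n s * (transpose_mat U * U) * mat_diag n s) * transpose_mat U"
    using U UT by (simp add: assoc_mult_mat[of _ n n _ n _ n] mult_carrier_mat[of _ n n _ n])
  also have "mat_diag n s * (transpose_mat U * U) * mat_diag n s = mat_diag n d"
    unfolding UU right_mult_one_mat[OF mat_diag_dim] mat_diag_diag using s(2)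
    by (auto simp: mat_diag_def intro!: eq_matI)
  finally have Q2: "?Q * ?Q = transpose_mat A * A" by (simp add: AA_eq)
  have psdQ: "pos_semidef_mat n ?Q"
    by (rule pos_semidef_mat_congruence_diag[OF U s(1)])
  have Q: "psd_sqrt (transpose_mat A * A) = ?Q" by (rule psd_sqrt_eqI[OF psdQ Q2])
  \<comment> \<open>Where \<open>s k = 0\<close>, also \<open>1 / s k = 0\<close>, and column \<open>k\<close> of \<open>W\<close> vanishes.\<close>
  define X where "X = W * mat_diag n (\<lambda>k. 1 / s k)"
  have X: "X \<in> carrier_mat m n" using mult_carrier_mat[OF W mat_diag_dim] by (simp add: X_def)
  \<comment> \<open>Since \<open>?P = X * transpose_mat W\<close>, the goal
    \<open>?P * ?P = W * transpose_mat W\<close> reduces to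
    \<open>X * (transpose_mat W * X) = W\<close>.\<close>
  have "transpose_mat W * X = mat_diag n (\<lambda>k. d k * (1 / s k))"
    unfolding X_def by (simp add: WW flip: assoc_mult_mat[OF WT W mat_diag_dim])
  then have "X * (transpose_mat W * X) = W * mat_diag n (\<lambda>k. 1 / s k * (d k * (1 / s k)))"
    by (simp add: X_def assoc_mult_mat[OF W mat_diag_dim mat_diag_dim])
  also have "\<dots> = W"
  proof (rule eq_matI)
    fix l k assume "l < dim_row W" "k < dim_col W"
    then have lk: "l < m" "k < n" using W by auto
    then have "W $$ (l, k) * (1 / s k * (d k * (1 / s k))) = W $$ (l, k)"
      using W_zero[OF lk(2) _ lk(1)] s(2)[OF lk(2)]
      by (cases "d k = 0") (auto simp: field_simps)
    then show "(W * mat_diag n (\<lambda>k. 1 / s k * (d k * (1 / s k)))) $$ (l, k) = W $$ (l, k)"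
      using lk by (simp add: mat_diag_mult_right[OF W])
  qed (use W in \<open>simp_all add: mat_diag_mult_right[OF W]\<close>)
  finally have XWX: "X * (transpose_mat W * X) = W" .
  have "?P * ?P = X * (transpose_mat W * X) * transpose_mat W"
    unfolding X_def[symmetric] using X WT
    by (simp add: assoc_mult_mat[of _ m n _ m _ m] assoc_mult_mat[of _ n m _ n _ m]
        assoc_mult_mat[of _ m n _ n _ m] mult_carrier_mat[of _ m n _ m] mult_carrier_mat[of _ n m _ n])
  also have "\<dots> = W * transpose_mat W" unfolding XWX ..
  also have "\<dots> = A * (U * transpose_mat U) * transpose_mat A"
    unfolding WT_eq unfolding W_def using A AT U UT
    by (simp add: assoc_mult_mat[of _ m n _ n _ m] assoc_mult_mat[of _ m n _ n _ n]
      assoc_mult_mat[of _ n n _ n _ m])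
  finally have P2: "?P * ?P = A * transpose_mat A" using UU' A by simp
  have psdP: "pos_semidef_mat m ?P"
    by (rule pos_semidef_mat_congruence_diag[OF W]) (simp add: s(1))
  have P: "psd_sqrt (A * transpose_mat A) = ?P" by (rule psd_sqrt_eqI[OF psdP P2])
  \<comment> \<open>Here \<open>sqrt (s k)\<close> is the fourth root of the eigenvalue
    \<open>d k\<close>; this weight makes the squares of \<open>f\<close> and \<open>g\<close> sum
    to diagonal entries of \<open>?P\<close> and \<open>?Q\<close>.\<close>
  define f where "f k = W $$ (i, k) / sqrt (s k)" for k
  define g where "g k = sqrt (s k) * U $$ (j, k)" for k
  have "A = W * transpose_mat U"
    unfolding W_def using A U UT UU' by (simp add: assoc_mult_mat[of _ m n _ n _ n])
  then have "A $$ (i, j) = (\<Sum>k<n. W $$ (i, k) * U $$ (j, k))"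
    using W U i j by (simp add: scalar_prod_def atLeast0LessThan)
  \<comment> \<open>If \<open>s k = 0\<close>, both summands are 0: the right one by division by
    zero, the left one because column \<open>k\<close> of \<open>W\<close> vanishes.\<close>
  also have "\<dots> = (\<Sum>k<n. (W $$ (i, k) / sqrt (s k)) * (sqrt (s k) * U $$ (j, k)))"
    using W_zero i s by (intro sum.cong) (auto simp: s_def)
  finally have A_eq: "A $$ (i, j) = (\<Sum>k<n. f k * g k)" unfolding f_def g_def .
  have "\<bar>A $$ (i, j)\<bar> \<le> (\<Sum>k<n. \<bar>f k\<bar> * \<bar>g k\<bar>)"
    unfolding A_eq by (rule order_trans[OF sum_abs]) (simp add: abs_mult)
  also have "\<dots> \<le> L2_set f {..<n} * L2_set g {..<n}" by (rule L2_set_mult_ineq)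
  finally have "(A $$ (i, j))\<^sup>2 \<le> (L2_set f {..<n} * L2_set g {..<n})\<^sup>2"
    by (metis abs_ge_zero power2_abs power_mono)
  also have "\<dots> = (\<Sum>k<n. (f k)\<^sup>2) * (\<Sum>k<n. (g k)\<^sup>2)"
    by (simp add: L2_set_def power_mult_distrib sum_nonneg)
  also have "(\<Sum>k<n. (f k)\<^sup>2) = ?P $$ (i, i)"
    unfolding index_congruence_diag[OF W W i i] using s(1)
    by (intro sum.cong) (auto simp: f_def power2_eq_square)
  also have "(\<Sum>k<n. (g k)\<^sup>2) = ?Q $$ (j, j)"
    unfolding index_congruence_diag[OF U U j j] using s(1)
    by (intro sum.cong) (auto simp: g_def power_mult_distrib, simp add: power2_eq_square)
  finally show ?thesis unfolding P Q .
qed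

section \<open>Application to the adjacency matrix\<close>

theorem theorem4:
  fixes G :: "'a pair_pre_digraph" and vs :: "'a list" and i j :: nat
  assumes "pair_digraph G"
    and "vertex_numbering G vs"
    and "i < length vs" and "j < length vs"
    and "(vs ! i, vs ! j) \<in> parcs G"
  shows "outer_energy G vs i * inner_energy G vs j \<ge> 1"
proof -
  have "adjacency_mat G vs \<in> carrier_mat (length vs) (length vs)"
    by (simp add: adjacency_mat_def)
  moreover have "adjacency_mat G vs $$ (i, j) = 1"
    using assms by (simp add: adjacency_mat_def)
  ultimately show ?thesis
    using square_entry_le_psd_sqrt_diag[of "adjacency_mat G vs" "length vs" "length vs" i j] assms
    by (simp add: outer_energy_def inner_energy_def)
qed

end
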